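(* There are at least three pairwise inequivalent extremal Type II $\mathbb{Z}_4$-codes of length $56$.
   Context: A $\mathbb{Z}_4$-code of length $n$ is a $\mathbb{Z}_4$-submodule $\mathcal{C}$ of $\mathbb{Z}_4^n$, where $\mathbb{Z}_4=\{0,1,2,3\}$ is the ring of integers modulo $4$. Its dual is $\mathcal{C}^\perp=\{x\in\mathbb{Z}_4^n \mid x\cdot y=0 \text{ for all } y\in\mathcal{C}\}$, with $x\cdot y$ the standard inner product; $\mathcal{C}$ is self-dual if $\mathcal{C}=\mathcal{C}^\perp$. Two $\mathbb{Z}_4$-codes are equivalent if one can be obtained from the other by permuting the coordinates and (if necessary) changing the signs of certain coordinates. For $x\in\mathbb{Z}_4^n$ let $n_i(x)$ be the number of components of $x$ equal to $i$. The Euclidean weight of $x$ is $n_1(x)+4n_2(x)+n_3(x)$, and the minimum Euclidean weight of $\mathcal{C}$ is the smallest Euclidean weight among all non-zero codewords of $\mathcal{C}$. A self-dual $\mathbb{Z}_4$-code is Type II if the Euclidean weights of all its codewords are divisible by $8$. A Type II $\mathbb{Z}_4$-code of length $n$ is extremal if its minimum Euclidean weight equals $8\lfloor n/24\rfloor+8$ (so $24$ when $n=56$). *)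

theory Defs
  imports "HOL-Analysis.Analysis"
begin

(* The numeral type 4 of Numeral_Type has exactly four elements and arithmetic modulo 4 (so
   that 3 = -1), i.e. it is the ring of integers modulo 4.  Words of length n are elements of
   4 ^ 'n, with n = CARD('n). *)
type_synonym Z4 = 4

(* Makes the facts of the locale module (such as module.subspace_def) available for the
   componentwise scalar multiplication. *)
lemma module_Z4_vec: "module ((*s) :: Z4 \<Rightarrow> Z4 ^ 'n \<Rightarrow> Z4 ^ 'n)"
  by (rule module.intro) (simp_all add: vec_eq_iff algebra_simps)

definition Z4_code :: "(Z4 ^ 'n) set \<Rightarrow> bool" where
  "Z4_code C \<longleftrightarrow> module.subspace (*s) C"

definition dual_code :: "(Z4 ^ 'n) set \<Rightarrow> (Z4 ^ 'n) set" where
  "dual_code C = {x. \<forall>y\<in>C. scalar_product x y = 0}"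

definition self_dual :: "(Z4 ^ 'n) set \<Rightarrow> bool" where
  "self_dual C \<longleftrightarrow> Z4_code C \<and> C = dual_code C"

definition code_equiv :: "(Z4 ^ 'n) set \<Rightarrow> (Z4 ^ 'n) set \<Rightarrow> bool" where
  "code_equiv C D \<longleftrightarrow>
     (\<exists>(p :: 'n \<Rightarrow> 'n) (s :: 'n \<Rightarrow> Z4).
        bij p \<and> (\<forall>i. s i = 1 \<or> s i = -1) \<and> D = (\<lambda>x. \<chi> i. s i * x $ p i) ` C)"

definition num_comp :: "Z4 \<Rightarrow> Z4 ^ 'n \<Rightarrow> nat" where
  "num_comp a x = card {i. x $ i = a}"

definition euclidean_weight :: "Z4 ^ 'n \<Rightarrow> nat" where
  "euclidean_weight x = num_comp 1 x + 4 * num_comp 2 x + num_comp 3 x"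

(* The set of weights is finite; it is empty, and the value then unspecified, only for C
   contained in {0}, which is never a self-dual code of positive length. *)
definition min_euclidean_weight :: "(Z4 ^ 'n) set \<Rightarrow> nat" where
  "min_euclidean_weight C = Min (euclidean_weight ` (C - {0}))"

definition type_II :: "(Z4 ^ 'n) set \<Rightarrow> bool" where
  "type_II C \<longleftrightarrow> self_dual C \<and> (\<forall>x\<in>C. 8 dvd euclidean_weight x)"

definition extremal_type_II :: "(Z4 ^ 'n) set \<Rightarrow> bool" where
  "extremal_type_II C \<longleftrightarrow>
     type_II C \<and> min_euclidean_weight C = 8 * (CARD('n) div 24) + 8"

end

theory Submission
  imports Defs
begin

text \<open>
  Let \<open>R\<close> be a doubly even binary code of length 56 that contains the all-one word, with minimum
  weight at least 20 and with dual minimum weight at least 6. Any Type II code \<open>C\<close> with residue code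
  \<open>R\<close> is extremal: a word of \<open>C\<close> with nonzero residue has at least 20 odd entries, hence Euclidean
  weight at least 20 and so at least 24 by divisibility, while a word with zero residue is \<open>2 t\<close> with
  \<open>t\<close> in the dual of \<open>R\<close> and has Euclidean weight 4 times the weight of \<open>t\<close>. The dual of \<open>R\<close> has no
  words of weight 2 and 4 precisely if the sums of two columns of a generator matrix are pairwise
  distinct. Equivalent codes have residue codes of the same size, so it suffices to exhibit suitable
  residue codes of dimensions 13, 14 and 15; the second is a subcode of the third.
\<close>

section \<open>Integers modulo 4: integer representatives and doubling\<close>

lemma of_int_Z4_eq_0_iff: "(of_int z :: Z4) = 0 \<longleftrightarrow> 4 dvd z"
  by (simp add: of_int_eq_0_iff_char_dvd)

lemma of_nat_Z4_eq_0_iff: "(of_nat n :: Z4) = 0 \<longleftrightarrow> 4 dvd n"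
  by (simp add: of_nat_eq_0_iff_char_dvd)

lemma of_int_Z4_eq_iff: "(of_int y :: Z4) = of_int z \<longleftrightarrow> 4 dvd y - z"
  using of_int_Z4_eq_0_iff[of "y - z"] by simp

lemma Z4_of_int_ex: "\<exists>z. (a :: Z4) = of_int z"
  by (cases a) blast

lemma two_times_of_int_eq_0_iff: "2 * (of_int z :: Z4) = 0 \<longleftrightarrow> even z"
proof -
  have "2 * (of_int z :: Z4) = of_int (2 * z)" by simp
  then show ?thesis by (simp only: of_int_Z4_eq_0_iff) presburger
qed

lemma two_times_eq_0_Z4:
  assumes "2 * (a :: Z4) = 0"
  obtains b where "a = 2 * b"
proof -
  obtain z where z: "a = of_int z" using Z4_of_int_ex by blast
  with assms have "even z" by (simp add: two_times_of_int_eq_0_iff)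
  then obtain w where "z = 2 * w" by blast
  with z that[of "of_int w"] show thesis by simp
qed

lemma two_times_Z4_cases: "2 * (a :: Z4) = 0 \<or> 2 * a = 2"
proof -
  obtain z where z: "a = of_int z" using Z4_of_int_ex by blast
  have "2 * (a - 1) = 0 \<or> 2 * a = 0"
    using two_times_of_int_eq_0_iff[of z] two_times_of_int_eq_0_iff[of "z - 1"] z by auto
  then show ?thesis by (auto simp: algebra_simps)
qed

lemma double_double_Z4: "2 * (2 * (c :: Z4)) = 0"
proof -
  have "2 * (2 * c) = 4 * c" "(4 :: Z4) = 0" by simp_all
  then show ?thesis by (simp only: mult_zero_left)
qed

lemma double_double_Z4_vec: "2 *s (2 *s (x :: Z4 ^ 'n)) = 0"
  unfolding vec_eq_iff vector_smult_component double_double_Z4 by simp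

text \<open>The kernel of doubling lies in its image, so a word with zero residue modulo 2 can be
  halved.\<close>

lemma two_times_eq_0_Z4_vec:
  assumes "2 *s (x :: Z4 ^ 'n) = 0"
  obtains y where "x = 2 *s y"
proof -
  have "\<exists>b. x $ i = 2 * b" for i
    using assms two_times_eq_0_Z4[of "x $ i"] by (metis vector_smult_component zero_index)
  then obtain f where f: "x $ i = 2 * f i" for i by metis
  then have "x = 2 *s (\<chi> i. f i)" by (simp add: vec_eq_iff)
  then show thesis by (rule that)
qed

section \<open>Bilinearity of the inner product\<close>

lemma scalar_product_commute: "scalar_product x y = scalar_product y (x :: Z4 ^ 'n)"
  by (simp add: scalar_product_def mult.commute)

lemma scalar_product_add_left:
  "scalar_product (x + y) z = scalar_product x z + scalar_product y (z :: Z4 ^ 'n)"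
  by (simp add: scalar_product_def algebra_simps sum.distrib)

lemma scalar_product_diff_left:
  "scalar_product (x - y) z = scalar_product x z - scalar_product y (z :: Z4 ^ 'n)"
  by (simp add: scalar_product_def algebra_simps sum_subtractf)

lemma scalar_product_scale_left: "scalar_product (c *s x) y = c * scalar_product x (y :: Z4 ^ 'n)"
  by (simp add: scalar_product_def sum_distrib_left mult.assoc)

lemma scalar_product_sum_left:
  "scalar_product (\<Sum>i\<in>I. f i) y = (\<Sum>i\<in>I. scalar_product (f i) (y :: Z4 ^ 'n))"
  unfolding scalar_product_def sum_component sum_distrib_right by (rule sum.swap)

lemma scalar_product_axis: "scalar_product (axis i 1) (y :: Z4 ^ 'n) = y $ i"
  by (simp add: scalar_product_def axis_def if_distrib[of "\<lambda>u. u * _"] cong: if_cong)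

lemmas scalar_product_left_simps =
  scalar_product_add_left scalar_product_diff_left scalar_product_scale_left

lemma scalar_product_right_simps:
  "scalar_product x (y + z) = scalar_product x y + scalar_product x (z :: Z4 ^ 'n)"
  "scalar_product x (y - z) = scalar_product x y - scalar_product x z"
  "scalar_product x (c *s y) = c * scalar_product x y"
  using scalar_product_left_simps(1,2)[of y z x] scalar_product_left_simps(3)[of c y x]
  by (simp_all add: scalar_product_commute[of x])

subsection \<open>Euclidean weights modulo 8\<close>

text \<open>The square of the representative of least absolute value.\<close>

definition eweight :: "Z4 \<Rightarrow> nat" where
  "eweight a = (if a = 0 then 0 else if a = 2 then 4 else 1)"

lemma euclidean_weight_eq_sum: "euclidean_weight x = (\<Sum>i\<in>UNIV. eweight (x $ i))"
proof -
  have num: "num_comp a x = (\<Sum>i\<in>UNIV. of_bool (x $ i = a))" for a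
    by (simp add: num_comp_def)
  have *: "of_bool (a = 1) + 4 * of_bool (a = 2) + of_bool (a = 3) = eweight a" for a :: Z4
  proof -
    have "a \<in> {0, 1, 2, 3}"
    proof -
      have "{0, 1, 2, 3} = (UNIV :: Z4 set)" by (intro card_subset_eq) simp_all
      then show ?thesis by blast
    qed
    then show ?thesis by (auto simp: eweight_def)
  qed
  show ?thesis
    unfolding euclidean_weight_def num sum_distrib_left sum.distrib[symmetric] * ..
qed

text \<open>A square modulo 8 depends only on the class modulo 4: odd squares are 1, and
  \<open>4 * m * m\<close> is 0 or 4 by the parity of \<open>m\<close>. So Euclidean weights modulo
  8 can be computed as integer norms.\<close>

lemma eweight_cong: "8 dvd int (eweight (of_int z)) - z\<^sup>2"
proof (cases "even z")
  case True
  then obtain m where m: "z = 2 * m" by blast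
  have z: "(of_int z :: Z4) = 0 \<longleftrightarrow> even m" "(of_int z :: Z4) = 2 \<longleftrightarrow> odd m"
    using of_int_Z4_eq_iff[of z 0] of_int_Z4_eq_iff[of z 2] m by (simp_all, presburger+)
  show ?thesis
  proof (cases "even m")
    case True
    then obtain k where "m = 2 * k" by blast
    then show ?thesis using z m by (simp add: eweight_def power2_eq_square)
  next
    case False
    then obtain k where "m = 2 * k + 1" by (rule oddE)
    then have "int (eweight (of_int z)) - z\<^sup>2 = 8 * (- 2 * k * (k + 1))"
      using z m by (simp add: eweight_def power2_eq_square algebra_simps)
    then show ?thesis by (metis dvd_triv_left)
  qed
next
  case False
  then obtain m where m: "z = 2 * m + 1" by (rule oddE)
  have "even (m * (m + 1))" by simp
  then obtain k where k: "m * (m + 1) = 2 * k" by blast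
  have "eweight (of_int z) = 1"
    using of_int_Z4_eq_iff[of z 0] of_int_Z4_eq_iff[of z 2] m unfolding eweight_def
    by (auto, presburger+)
  then have "int (eweight (of_int z)) - z\<^sup>2 = 8 * (- k)"
    using m k by (simp add: power2_eq_square algebra_simps)
  then show ?thesis by (metis dvd_triv_left)
qed

lemma euclidean_weight_of_int:
  "8 dvd int (euclidean_weight (\<chi> i. of_int (z i))) - (\<Sum>i\<in>UNIV. (z i)\<^sup>2)"
  by (simp add: euclidean_weight_eq_sum eweight_cong dvd_sum flip: sum_subtractf)

lemma Z4_vec_of_int_ex: "\<exists>z. (x :: Z4 ^ 'n) = (\<chi> i. of_int (z i))"
proof -
  have "\<exists>z. \<forall>i. x $ i = of_int (z i)" using Z4_of_int_ex by (intro choice) blast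
  then obtain z where "\<forall>i. x $ i = of_int (z i)" by blast
  then have "x = (\<chi> i. of_int (z i))" by (simp add: vec_eq_iff)
  then show ?thesis by blast
qed

lemma scalar_product_of_int_eq_0_iff:
  "scalar_product (\<chi> i. of_int (y i)) (\<chi> i. (of_int (z i) :: Z4)) = 0 \<longleftrightarrow> 4 dvd (\<Sum>i\<in>UNIV. y i * z i)"
proof -
  have "scalar_product (\<chi> i. of_int (y i)) (\<chi> i. (of_int (z i) :: Z4)) = of_int (\<Sum>i\<in>UNIV. y i * z i)"
    by (simp add: scalar_product_def)
  then show ?thesis by (simp only: of_int_Z4_eq_0_iff)
qed

text \<open>Polarization: the norm of a sum of integer lifts has the cross term twice their inner
  product, and that inner product is divisible by 4.\<close>

lemma euclidean_weight_add_dvd: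
  assumes "scalar_product x y = 0" "8 dvd euclidean_weight x" "8 dvd euclidean_weight y"
  shows "8 dvd euclidean_weight (x + y)"
proof -
  obtain u v where x: "x = (\<chi> i. of_int (u i))" and y: "y = (\<chi> i. of_int (v i))"
    using Z4_vec_of_int_ex by metis
  have xy: "x + y = (\<chi> i. of_int (u i + v i))" by (simp add: x y vec_eq_iff)
  have "4 dvd (\<Sum>i\<in>UNIV. u i * v i)"
    using assms(1) unfolding x y scalar_product_of_int_eq_0_iff .
  then have uv: "8 dvd 2 * (\<Sum>i\<in>UNIV. u i * v i)" by presburger
  have sum: "(\<Sum>i\<in>UNIV. (u i + v i)\<^sup>2)
      = (\<Sum>i\<in>UNIV. (u i)\<^sup>2) + (\<Sum>i\<in>UNIV. (v i)\<^sup>2) + 2 * (\<Sum>i\<in>UNIV. u i * v i)"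
    by (simp add: power2_sum sum.distrib sum_distrib_left mult.assoc)
  have "8 dvd int (euclidean_weight x)" "8 dvd int (euclidean_weight y)"
    using assms(2,3) by presburger+
  then have "8 dvd int (euclidean_weight (x + y))"
    using euclidean_weight_of_int[of u] euclidean_weight_of_int[of v] uv
      euclidean_weight_of_int[of "\<lambda>i. u i + v i"]
    unfolding xy[symmetric] x[symmetric] y[symmetric] sum by presburger
  then show ?thesis by presburger
qed

text \<open>Scaling is repeated addition, and \<open>x\<close> is orthogonal to its own
  multiples.\<close>

lemma euclidean_weight_scale_dvd:
  assumes "scalar_product x x = 0" "8 dvd euclidean_weight x"
  shows "8 dvd euclidean_weight (a *s x)"
proof -
  have "8 dvd euclidean_weight (of_nat m *s x)" for m
  proof (induction m)
    case 0
    then show ?case by (simp add: euclidean_weight_eq_sum eweight_def)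
  next
    case (Suc m)
    have "of_nat (Suc m) *s x = x + of_nat m *s x"
      by (simp add: vec_eq_iff algebra_simps)
    moreover have "scalar_product x (of_nat m *s x) = 0"
      by (subst scalar_product_commute) (simp add: scalar_product_scale_left assms)
    ultimately show ?case using euclidean_weight_add_dvd Suc assms(2) by metis
  qed
  moreover obtain m where "a = of_nat m"
    by (cases a) (metis of_int_of_nat_eq zero_le_imp_eq_int)
  ultimately show ?thesis by blast
qed

text \<open>The support of the residue of \<open>x\<close> modulo 2. Oddness is tested by doubling,
  so residues are handled inside \<open>Z4\<close>, as the words \<open>2 *s x\<close>.\<close>

definition odd_coords :: "Z4 ^ 'n \<Rightarrow> 'n set" where
  "odd_coords x = {i. 2 * x $ i \<noteq> 0}"

lemma odd_coords_cong: "2 *s x = 2 *s y \<Longrightarrow> odd_coords x = odd_coords y"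
  by (simp add: odd_coords_def vec_eq_iff)

lemma odd_coords_eq_empty_iff: "odd_coords x = {} \<longleftrightarrow> 2 *s x = 0"
  by (auto simp: odd_coords_def vec_eq_iff)

lemma card_odd_coords_le_euclidean_weight: "card (odd_coords x) \<le> euclidean_weight x"
proof -
  have "card (odd_coords x) = (\<Sum>i\<in>UNIV. of_bool (2 * x $ i \<noteq> 0))"
    by (simp add: odd_coords_def)
  also have "\<dots> \<le> euclidean_weight x"
    unfolding euclidean_weight_eq_sum by (intro sum_mono) (simp add: eweight_def)
  finally show ?thesis .
qed

lemma euclidean_weight_double: "euclidean_weight (2 *s x) = 4 * card (odd_coords x)"
proof -
  have "eweight (2 * a) = 4 * of_bool (2 * a \<noteq> 0)" for a
    using two_times_Z4_cases[of a] by (auto simp: eweight_def)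
  then have "euclidean_weight (2 *s x) = 4 * (\<Sum>i\<in>UNIV. of_bool (2 * x $ i \<noteq> 0))"
    by (simp only: euclidean_weight_eq_sum vector_smult_component sum_distrib_left)
  also have "\<dots> = 4 * card (odd_coords x)"
    by (simp add: odd_coords_def)
  finally show ?thesis .
qed

text \<open>Doubling retains only the parity of the inner product, so this is orthogonality of the
  binary residues.\<close>

lemma two_scalar_product_eq_0_iff:
  "2 * scalar_product x y = 0 \<longleftrightarrow> even (card (odd_coords x \<inter> odd_coords y))"
proof -
  have *: "2 * (a * b) = 2 * of_bool (2 * a \<noteq> 0 \<and> 2 * b \<noteq> 0)" for a b :: Z4
  proof -
    have "2 * (a * b) = 2 * a * b" "2 * (a * b) = 2 * b * a" by (simp_all add: ac_simps)
    then show ?thesis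
      using two_times_Z4_cases[of a] two_times_Z4_cases[of b] by (elim disjE) simp_all
  qed
  have "2 * scalar_product x y = 2 * (\<Sum>i\<in>UNIV. of_bool (2 * x $ i \<noteq> 0 \<and> 2 * y $ i \<noteq> 0))"
    unfolding scalar_product_def sum_distrib_left * ..
  also have "\<dots> = 2 * of_nat (card (odd_coords x \<inter> odd_coords y))"
    by (simp add: odd_coords_def flip: Collect_conj_eq)
  also have "\<dots> = of_nat (2 * card (odd_coords x \<inter> odd_coords y))"
    by simp
  also have "\<dots> = 0 \<longleftrightarrow> even (card (odd_coords x \<inter> odd_coords y))"
    unfolding of_nat_Z4_eq_0_iff by presburger
  finally show ?thesis .
qed

subsection \<open>Self-dual lifts\<close>

definition comb :: "(nat \<Rightarrow> Z4 ^ 'n) \<Rightarrow> nat \<Rightarrow> (nat \<Rightarrow> Z4) \<Rightarrow> Z4 ^ 'n" where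
  "comb g k a = (\<Sum>i<k. a i *s g i)"

text \<open>The residue of \<open>t\<close> lies in the binary dual of the code spanned by the
  residues of the first \<open>k\<close> generators.\<close>

definition annihilates :: "(nat \<Rightarrow> Z4 ^ 'n) \<Rightarrow> nat \<Rightarrow> Z4 ^ 'n \<Rightarrow> bool" where
  "annihilates g k t \<longleftrightarrow> (\<forall>i<k. 2 * scalar_product t (g i) = 0)"

text \<open>The torsion part is the whole dual of the residue code, which is what makes the code
  self-dual.\<close>

definition lift_code :: "(nat \<Rightarrow> Z4 ^ 'n) \<Rightarrow> nat \<Rightarrow> (Z4 ^ 'n) set" where
  "lift_code g k = {comb g k a + 2 *s t | a t. annihilates g k t}"

lemma scalar_product_comb: "scalar_product (comb g k a) y = (\<Sum>i<k. a i * scalar_product (g i) y)"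
  by (simp add: comb_def scalar_product_sum_left scalar_product_scale_left)

text \<open>A binary linear code is the dual of its dual, stated for residues.\<close>

lemma double_annihilator:
  assumes "\<And>t. annihilates g k t \<Longrightarrow> 2 * scalar_product t y = 0"
  shows "\<exists>a. 2 *s y = 2 *s comb g k a"
  using assms
proof (induction k arbitrary: y)
  case 0
  \<comment> \<open>Without generators every word annihilates, in particular each unit
    vector.\<close>
  have "2 * y $ i = 0" for i
    using 0[of "axis i 1"] by (simp add: annihilates_def scalar_product_axis)
  then show ?case by (simp add: comb_def vec_eq_iff)
next
  case (Suc k)
  show ?case
  proof (cases "\<exists>t. annihilates g k t \<and> 2 * scalar_product t (g k) \<noteq> 0")
    case True
    then obtain t0 where t0: "annihilates g k t0" "2 * scalar_product t0 (g k) = 2"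
      using two_times_Z4_cases by blast
    \<comment> \<open>Modulo 2, \<open>t0\<close> pairs to 1 with \<open>g k\<close> and to 0 with
      the earlier generators, so \<open>b\<close> has to be the coefficient of
      \<open>g k\<close>.\<close>
    define b where "b = scalar_product t0 y"
    have "2 * scalar_product t (y - b *s g k) = 0" if t: "annihilates g k t" for t
    proof -
      define c where "c = scalar_product t (g k)"
      \<comment> \<open>Subtracting \<open>c *s t0\<close> cancels the pairing of \<open>t\<close>
        with \<open>g k\<close> modulo 2.\<close>
      have "annihilates g (Suc k) (t - c *s t0)"
        using t t0 by (auto simp: annihilates_def less_Suc_eq scalar_product_left_simps c_def
            right_diff_distrib mult.left_commute[of 2])
      then have "2 * scalar_product (t - c *s t0) y = 0" by (rule Suc.prems)
      then have "2 * scalar_product t y = 2 * (c * b)"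
        by (simp add: scalar_product_left_simps b_def right_diff_distrib)
      then show ?thesis
        by (simp add: scalar_product_right_simps c_def right_diff_distrib mult.commute[of b])
    qed
    from Suc.IH[OF this] obtain a where "2 *s (y - b *s g k) = 2 *s comb g k a" by blast
    then have "2 *s y = 2 *s comb g (Suc k) (a(k := b))"
      by (simp add: comb_def vec_eq_iff algebra_simps)
    then show ?thesis by blast
  next
    case False
    \<comment> \<open>Here \<open>g k\<close> imposes no new condition on annihilators, so the
      coefficient 0 will do for it.\<close>
    then have "\<exists>a. 2 *s y = 2 *s comb g k a"
      by (intro Suc.IH Suc.prems) (auto simp: annihilates_def less_Suc_eq)
    then obtain a where "2 *s y = 2 *s comb g k a" by blast
    then have "2 *s y = 2 *s comb g (Suc k) (a(k := 0))" by (simp add: comb_def)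
    then show ?thesis by blast
  qed
qed

lemma annihilates_comb:
  assumes "annihilates g k t"
  shows "2 * scalar_product t (comb g k a) = 0"
proof -
  have "2 * scalar_product (comb g k a) t = (\<Sum>i<k. a i * (2 * scalar_product t (g i)))"
    unfolding scalar_product_comb sum_distrib_left
    by (intro sum.cong refl) (simp add: scalar_product_commute[of t] mult.left_commute)
  also have "\<dots> = 0" using assms by (simp add: annihilates_def)
  finally show ?thesis by (simp add: scalar_product_commute)
qed

context
  fixes g :: "nat \<Rightarrow> Z4 ^ 'n" and k :: nat
  assumes orth: "\<And>i j. i < k \<Longrightarrow> j < k \<Longrightarrow> scalar_product (g i) (g j) = 0"
begin

lemma scalar_product_comb_comb: "scalar_product (comb g k a) (comb g k b) = 0"
proof -
  have "scalar_product (g i) (comb g k b) = 0" if "i < k" for i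
    using that orth by (subst scalar_product_commute) (simp add: scalar_product_comb)
  then show ?thesis by (simp add: scalar_product_comb)
qed

text \<open>Mixed terms vanish by annihilation, and the product of two torsion parts carries a
  factor 4.\<close>

lemma scalar_product_lift_code:
  assumes "x \<in> lift_code g k" "y \<in> lift_code g k"
  shows "scalar_product x y = 0"
proof -
  obtain a s b t where *: "x = comb g k a + 2 *s s" "annihilates g k s"
    "y = comb g k b + 2 *s t" "annihilates g k t"
    using assms unfolding lift_code_def by blast
  have "scalar_product x y = 2 * scalar_product s (comb g k b) + 2 * scalar_product t (comb g k a)
      + 2 * (2 * scalar_product s t)"
    unfolding *
    by (simp add: scalar_product_left_simps scalar_product_right_simps scalar_product_comb_comb
        scalar_product_commute[of "comb g k a" t])
  then show ?thesis using * by (simp only: annihilates_comb double_double_Z4 add_0)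
qed

lemma gen_in_lift_code:
  assumes "i < k" shows "g i \<in> lift_code g k"
proof -
  have "comb g k (\<lambda>j. of_bool (j = i)) = (\<Sum>j<k. if j = i then g i else 0)"
    unfolding comb_def by (intro sum.cong) auto
  also have "\<dots> = g i" using assms by simp
  finally have "g i = comb g k (\<lambda>j. of_bool (j = i)) + 2 *s 0" by simp
  moreover have "annihilates g k 0" by (simp add: annihilates_def scalar_product_def)
  ultimately show ?thesis unfolding lift_code_def by blast
qed

lemma double_in_lift_code:
  assumes "annihilates g k t" shows "2 *s t \<in> lift_code g k"
proof -
  have "2 *s t = comb g k (\<lambda>_. 0) + 2 *s t" by (simp add: comb_def)
  then show ?thesis using assms unfolding lift_code_def by blast
qed

text \<open>Orthogonality to the torsion words determines the residue of a dual word; orthogonality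
  to the generators then controls what is left after subtracting a combination with that
  residue.\<close>

lemma lift_code_eq_dual: "lift_code g k = dual_code (lift_code g k)"
proof
  show "lift_code g k \<subseteq> dual_code (lift_code g k)"
    using scalar_product_lift_code by (auto simp: dual_code_def)
  show "dual_code (lift_code g k) \<subseteq> lift_code g k"
  proof
    fix y assume "y \<in> dual_code (lift_code g k)"
    then have y: "scalar_product y x = 0" if "x \<in> lift_code g k" for x
      using that by (simp add: dual_code_def)
    have "2 * scalar_product t y = 0" if "annihilates g k t" for t
      using y[OF double_in_lift_code[OF that]]
      by (simp add: scalar_product_right_simps scalar_product_commute[of y])
    then obtain a where "2 *s y = 2 *s comb g k a" using double_annihilator by blast
    then have "2 *s (y - comb g k a) = 0" by (simp add: vec_eq_iff right_diff_distrib)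
    then obtain t where t: "y - comb g k a = 2 *s t" by (rule two_times_eq_0_Z4_vec)
    have "2 * scalar_product t (g i) = 0" if "i < k" for i
    proof -
      have "2 * scalar_product t (g i) = scalar_product (y - comb g k a) (g i)"
        by (simp add: t scalar_product_scale_left)
      also have "\<dots> = 0"
        using that y gen_in_lift_code orth by (simp add: scalar_product_left_simps scalar_product_comb)
      finally show ?thesis .
    qed
    moreover have "y = comb g k a + 2 *s t" using t by (simp add: algebra_simps)
    ultimately show "y \<in> lift_code g k" unfolding lift_code_def annihilates_def by blast
  qed
qed

lemma self_dual_lift_code: "self_dual (lift_code g k)"
proof -
  \<comment> \<open>Every dual is a submodule, so the code inherits this from being its own
    dual.\<close>
  have "module.subspace (*s) (dual_code C)" for C :: "(Z4 ^ 'n) set"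
    unfolding module.subspace_def[OF module_Z4_vec]
    by (simp add: dual_code_def scalar_product_left_simps) (simp add: scalar_product_def)
  then show ?thesis unfolding self_dual_def Z4_code_def using lift_code_eq_dual by metis
qed

lemma lift_code_dvd_8:
  assumes k: "0 < k" and one: "g 0 = 1"
    and norm: "\<And>i. i < k \<Longrightarrow> 8 dvd euclidean_weight (g i)"
    and x: "x \<in> lift_code g k"
  shows "8 dvd euclidean_weight x"
proof -
  have comb: "8 dvd euclidean_weight (comb g m a)" if "m \<le> k" for m a
    using that
  proof (induction m)
    case 0
    then show ?case by (simp add: comb_def euclidean_weight_eq_sum eweight_def)
  next
    case (Suc m)
    have "scalar_product (comb g m a) (a m *s g m) = 0"
      using Suc.prems orth by (simp add: scalar_product_right_simps scalar_product_comb)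
    moreover have "8 dvd euclidean_weight (a m *s g m)"
      using Suc.prems orth norm by (intro euclidean_weight_scale_dvd) auto
    ultimately show ?case
      using Suc euclidean_weight_add_dvd by (simp add: comb_def)
  qed
  obtain a t where *: "x = comb g k a + 2 *s t" "annihilates g k t"
    using x unfolding lift_code_def by blast
  \<comment> \<open>Orthogonality to the all-one generator makes the weight of \<open>t\<close>
    even, so that of \<open>2 *s t\<close> is divisible by 8.\<close>
  have "2 * scalar_product t 1 = 0" using * k one by (metis annihilates_def)
  moreover have "odd_coords (1 :: Z4 ^ 'n) = UNIV" by (auto simp: odd_coords_def)
  ultimately have "even (card (odd_coords t))" by (simp add: two_scalar_product_eq_0_iff)
  then have "8 dvd euclidean_weight (2 *s t)"
    unfolding euclidean_weight_double by presburger
  moreover have "scalar_product (comb g k a) (2 *s t) = 0"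
    using annihilates_comb[OF *(2)]
    by (simp add: scalar_product_right_simps scalar_product_commute[of "comb g k a"])
  ultimately show ?thesis
    unfolding * by (intro euclidean_weight_add_dvd comb) auto
qed

end

lemma comb_add: "comb g k (\<lambda>i. a i + b i) = comb g k a + comb g k b"
  by (simp add: comb_def sum.distrib vec_eq_iff algebra_simps)

lemma comb_double: "2 *s comb g k a = comb g k (\<lambda>i. 2 * a i)"
  unfolding comb_def by (simp add: vec_eq_iff sum_distrib_left mult.assoc)

lemma comb_cong: "(\<And>i. i < k \<Longrightarrow> a i = b i) \<Longrightarrow> comb g k a = comb g k b"
  by (simp add: comb_def)

lemma extremal_lift_code:
  fixes g :: "nat \<Rightarrow> Z4 ^ 'n"
  assumes card: "CARD('n) div 24 = 2" and k: "0 < k" and one: "g 0 = 1"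
    and orth: "\<And>i j. i < k \<Longrightarrow> j < k \<Longrightarrow> scalar_product (g i) (g j) = 0"
    and norm: "\<And>i. i < k \<Longrightarrow> 8 dvd euclidean_weight (g i)"
    and residue: "\<And>a. \<exists>i<k. 2 * a i \<noteq> 0 \<Longrightarrow> 20 \<le> card (odd_coords (comb g k a))"
    and torsion: "\<And>t. annihilates g k t \<Longrightarrow> odd_coords t \<noteq> {} \<Longrightarrow> 6 \<le> card (odd_coords t)"
    and tight: "annihilates g k t" "card (odd_coords t) = 6"
  shows "extremal_type_II (lift_code g k)"
proof -
  have dvd: "8 dvd euclidean_weight x" if "x \<in> lift_code g k" for x
    by (rule lift_code_dvd_8[of k g]) (use orth k one norm that in auto)
  have low: "24 \<le> euclidean_weight x" if "x \<in> lift_code g k" "x \<noteq> 0" for x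
  proof -
    obtain a t where *: "x = comb g k a + 2 *s t" "annihilates g k t"
      using \<open>x \<in> lift_code g k\<close> unfolding lift_code_def by blast
    have x2: "2 *s x = 2 *s comb g k a"
      unfolding * by (simp only: vector_add_ldistrib double_double_Z4_vec add_0_right)
    show ?thesis
    proof (cases "\<exists>i<k. 2 * a i \<noteq> 0")
      case True
      then have "20 \<le> card (odd_coords x)"
        using residue odd_coords_cong[OF x2] by simp
      then have "20 \<le> euclidean_weight x"
        using card_odd_coords_le_euclidean_weight[of x] by linarith
      then show ?thesis using dvd[OF that(1)] by presburger
    next
      case False
      then have "2 *s comb g k a = 0"
        unfolding comb_double by (simp add: comb_def)
      then have "2 *s x = 0" using x2 by simp
      then obtain s where s: "x = 2 *s s" by (rule two_times_eq_0_Z4_vec)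
      have "2 * scalar_product s (g i) = 0" if i: "i < k" for i
      proof -
        have "2 * scalar_product s (g i) = scalar_product x (g i)"
          by (simp add: s scalar_product_left_simps)
        also have "\<dots> = 0"
          using * i orth by (simp add: scalar_product_left_simps scalar_product_comb annihilates_def)
        finally show ?thesis .
      qed
      moreover have "odd_coords s \<noteq> {}"
        using s \<open>x \<noteq> 0\<close> by (simp add: odd_coords_eq_empty_iff)
      ultimately have "6 \<le> card (odd_coords s)" by (intro torsion) (simp add: annihilates_def)
      then show ?thesis by (simp add: s euclidean_weight_double)
    qed
  qed
  \<comment> \<open>The word of weight 6 in the dual residue code, doubled, attains the bound
    24.\<close>
  have "2 *s t \<in> lift_code g k"
    by (rule double_in_lift_code) (use orth tight in auto)
  moreover have "2 *s t \<noteq> 0"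
    using tight odd_coords_eq_empty_iff[of t] by auto
  ultimately have "24 \<in> euclidean_weight ` (lift_code g k - {0})"
    using tight by (intro image_eqI[of _ _ "2 *s t"]) (simp_all add: euclidean_weight_double)
  then have "Min (euclidean_weight ` (lift_code g k - {0})) = 24"
    using low by (intro Min_eqI) auto
  then show ?thesis
    using dvd self_dual_lift_code[of k g] orth card
    by (simp add: extremal_type_II_def type_II_def min_euclidean_weight_def)
qed

subsection \<open>Size of the residue code\<close>

text \<open>The doubled code is a copy of the residue code: torsion parts disappear, and independent
  residues leave one word for each set of odd coefficients.\<close>

lemma card_double_lift_code:
  assumes indep: "\<And>a. \<exists>i<k. 2 * a i \<noteq> 0 \<Longrightarrow> odd_coords (comb g k a) \<noteq> {}"
  shows "card ((*s) 2 ` lift_code g k) = 2 ^ k"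
proof -
  let ?F = "\<lambda>A. 2 *s comb g k (\<lambda>i. of_bool (i \<in> A))"
  have "inj_on ?F (Pow {..<k})"
  proof (rule inj_onI)
    fix A B assume AB: "A \<in> Pow {..<k}" "B \<in> Pow {..<k}" "?F A = ?F B"
    \<comment> \<open>These coefficients are odd precisely on the symmetric difference of
      \<open>A\<close> and \<open>B\<close>.\<close>
    let ?a = "\<lambda>i. of_bool (i \<in> A) + of_bool (i \<in> B) :: Z4"
    have "2 *s comb g k ?a = ?F B + ?F B"
      using AB(3) by (simp add: comb_add vector_add_ldistrib)
    also have "\<dots> = 2 *s ?F B" by (simp only: vec_eq_iff vector_add_component vector_smult_component mult_2 simp_thms)
    also have "\<dots> = 0" by (rule double_double_Z4_vec)
    finally have "odd_coords (comb g k ?a) = {}" by (simp add: odd_coords_eq_empty_iff)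
    then have *: "2 * ?a i = 0" if "i < k" for i using that indep[of ?a] by blast
    have "i \<in> A \<longleftrightarrow> i \<in> B" if "i < k" for i
      using *[OF that] by (cases "i \<in> A"; cases "i \<in> B") simp_all
    then show "A = B" using AB(1,2) by auto
  qed
  moreover have "(*s) 2 ` lift_code g k = ?F ` Pow {..<k}"
  proof (intro subset_antisym subsetI)
    fix y assume "y \<in> (*s) 2 ` lift_code g k"
    then obtain a t where y: "y = 2 *s (comb g k a + 2 *s t)"
      unfolding lift_code_def by blast
    then have "y = comb g k (\<lambda>i. 2 * a i)"
      by (simp only: vector_add_ldistrib comb_double double_double_Z4_vec add_0_right)
    also have "\<dots> = comb g k (\<lambda>i. 2 * of_bool (i \<in> {i. i < k \<and> 2 * a i \<noteq> 0}))"
      by (intro comb_cong) (use two_times_Z4_cases in auto)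
    also have "\<dots> = ?F {i. i < k \<and> 2 * a i \<noteq> 0}" by (simp only: comb_double)
    finally show "y \<in> ?F ` Pow {..<k}" by blast
  next
    fix y assume "y \<in> ?F ` Pow {..<k}"
    moreover have "comb g k a \<in> lift_code g k" for a
    proof -
      have "comb g k a = comb g k a + 2 *s 0" "annihilates g k 0"
        by (simp_all add: annihilates_def scalar_product_def)
      then show ?thesis unfolding lift_code_def by blast
    qed
    ultimately show "y \<in> (*s) 2 ` lift_code g k" by blast
  qed
  ultimately show ?thesis by (simp add: card_image card_Pow)
qed

text \<open>Signed coordinate permutations are injective and commute with doubling.\<close>

lemma code_equiv_card_double:
  fixes C D :: "(Z4 ^ 'n) set"
  assumes "code_equiv C D"
  shows "card ((*s) 2 ` C) = card ((*s) 2 ` D)"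
proof -
  obtain p s where p: "bij p" and s: "\<And>i. s i = 1 \<or> s i = -1"
    and D: "D = (\<lambda>x. \<chi> i. s i * x $ p i) ` C"
    using assms unfolding code_equiv_def by blast
  let ?f = "\<lambda>x :: Z4 ^ 'n. (\<chi> i. s i * x $ p i) :: Z4 ^ 'n"
  have "inj ?f"
  proof (rule injI)
    fix x y assume "?f x = ?f y"
    then have eq: "s i * x $ p i = s i * y $ p i" for i by (simp add: vec_eq_iff)
    have *: "x $ p i = y $ p i" for i using eq[of i] s[of i] by auto
    show "x = y"
      unfolding vec_eq_iff
    proof
      fix j
      obtain i where "j = p i" using p by (metis bij_pointE)
      then show "x $ j = y $ j" using * by simp
    qed
  qed
  moreover have "(*s) 2 ` D = ?f ` (*s) 2 ` C"
    unfolding D image_image by (intro image_cong) (simp_all add: vec_eq_iff)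
  ultimately show ?thesis
    using card_image[OF inj_on_subset[of ?f UNIV "(*s) 2 ` C"]] by simp
qed


subsection \<open>Words given by lists\<close>

text \<open>An arbitrary numbering of the coordinates; another choice permutes all words given by
  lists in the same way.\<close>

definition pos :: "'n::finite \<Rightarrow> nat" where
  "pos = (SOME f. bij_betw f UNIV {..<CARD('n)})"

lemma bij_betw_pos: "bij_betw pos (UNIV :: 'n::finite set) {..<CARD('n)}"
  unfolding pos_def
  using someI_ex[OF ex_bij_betw_finite_nat[OF finite[of "UNIV :: 'n set"]]]
  by (simp add: atLeast0LessThan)

lemma pos_less: "pos (i :: 'n::finite) < CARD('n)"
  using bij_betw_pos by (auto simp: bij_betw_def)

lemma pos_eq_iff: "pos i = pos j \<longleftrightarrow> i = j"
  using bij_betw_pos by (auto simp: bij_betw_def inj_on_def)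

lemma sum_pos: "(\<Sum>i\<in>(UNIV :: 'n::finite set). f (pos i)) = (\<Sum>j<CARD('n). f j)"
  by (rule sum.reindex_bij_betw[OF bij_betw_pos])

definition of_list :: "int list \<Rightarrow> Z4 ^ 'n" where
  "of_list xs = (\<chi> i. of_int (xs ! pos i))"

fun dot :: "int list \<Rightarrow> int list \<Rightarrow> int" where
  "dot (x # xs) (y # ys) = x * y + dot xs ys"
| "dot _ _ = 0"

lemma dot_eq_sum: "length xs = length ys \<Longrightarrow> dot xs ys = (\<Sum>j<length xs. xs ! j * ys ! j)"
  by (induction xs ys rule: list_induct2) (simp_all add: sum.lessThan_Suc_shift del: sum.lessThan_Suc)

lemma sum_nth_pos:
  fixes xs ys :: "int list"
  assumes "length xs = CARD('n::finite)" "length ys = CARD('n)"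
  shows "(\<Sum>i\<in>(UNIV :: 'n set). xs ! pos i * ys ! pos i) = dot xs ys"
  using assms sum_pos[of "\<lambda>j. xs ! j * ys ! j"] by (simp add: dot_eq_sum)

context
  fixes xs ys :: "int list"
  assumes length: "length xs = CARD('n::finite)" "length ys = CARD('n)"
begin

lemma scalar_product_of_list: "scalar_product (of_list xs :: Z4 ^ 'n) (of_list ys) = of_int (dot xs ys)"
proof -
  have "scalar_product (of_list xs :: Z4 ^ 'n) (of_list ys)
      = of_int (\<Sum>i\<in>(UNIV :: 'n set). xs ! pos i * ys ! pos i)"
    by (simp add: scalar_product_def of_list_def)
  then show ?thesis by (simp only: sum_nth_pos[OF length])
qed

lemma scalar_product_of_list_eq_0_iff:
  "scalar_product (of_list xs :: Z4 ^ 'n) (of_list ys) = 0 \<longleftrightarrow> 4 dvd dot xs ys"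
  unfolding scalar_product_of_list of_int_Z4_eq_0_iff ..

lemma double_scalar_product_of_list_eq_0_iff:
  "2 * scalar_product (of_list xs :: Z4 ^ 'n) (of_list ys) = 0 \<longleftrightarrow> even (dot xs ys)"
  unfolding scalar_product_of_list two_times_of_int_eq_0_iff ..

end

lemma euclidean_weight_of_list_dvd:
  assumes "length xs = CARD('n::finite)" "8 dvd dot xs xs"
  shows "8 dvd euclidean_weight (of_list xs :: Z4 ^ 'n)"
proof -
  have "8 dvd int (euclidean_weight (of_list xs :: Z4 ^ 'n)) - dot xs xs"
    using euclidean_weight_of_int[where ?'a = 'n, of "\<lambda>i. xs ! pos i"] sum_nth_pos[OF assms(1) assms(1)]
    by (simp add: of_list_def power2_eq_square)
  with assms(2) have "8 dvd int (euclidean_weight (of_list xs :: Z4 ^ 'n))" by presburger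
  then show ?thesis by presburger
qed

subsection \<open>Parity vectors\<close>

definition parity :: "bool list \<Rightarrow> Z4 ^ 'n \<Rightarrow> bool" where
  "parity v x \<longleftrightarrow> length v = CARD('n) \<and> (\<forall>i. v ! pos i \<longleftrightarrow> i \<in> odd_coords x)"

lemma parity_of_list:
  assumes "length xs = CARD('n::finite)"
  shows "parity (map odd xs) (of_list xs :: Z4 ^ 'n)"
  using assms pos_less[where ?'n = 'n]
  by (simp add: parity_def odd_coords_def of_list_def two_times_of_int_eq_0_iff)

lemma odd_coords_add: "i \<in> odd_coords (x + y) \<longleftrightarrow> (i \<in> odd_coords x) \<noteq> (i \<in> odd_coords y)"
  using two_times_Z4_cases[of "x $ i"] two_times_Z4_cases[of "y $ i"]
  by (auto simp: odd_coords_def distrib_left)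

fun vxor :: "bool list \<Rightarrow> bool list \<Rightarrow> bool list" where
  "vxor (x # xs) (y # ys) = (x \<noteq> y) # vxor xs ys"
| "vxor _ _ = []"

lemma vxor_eq_map2: "vxor v w = map2 (\<noteq>) v w"
  by (induction v w rule: vxor.induct) auto

lemma vxor_commute: "vxor v w = vxor w v"
  by (induction v w rule: vxor.induct) auto

lemma parity_vxor: "parity v x \<Longrightarrow> parity w y \<Longrightarrow> parity (vxor v w) (x + y)"
  by (simp add: parity_def vxor_eq_map2 odd_coords_add pos_less)

fun trues :: "bool list \<Rightarrow> nat" where
  "trues [] = 0"
| "trues (True # v) = Suc (trues v)"
| "trues (False # v) = trues v"

lemma trues_eq_sum: "trues v = (\<Sum>j<length v. of_bool (v ! j))"
  by (induction v rule: trues.induct) (simp_all add: sum.lessThan_Suc_shift del: sum.lessThan_Suc sum_of_bool_eq)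

lemma trues_parity:
  assumes "parity v (x :: Z4 ^ 'n)"
  shows "trues v = card (odd_coords x)"
proof -
  have "trues v = (\<Sum>j<CARD('n). of_bool (v ! j))"
    using assms by (simp only: trues_eq_sum parity_def)
  also have "\<dots> = (\<Sum>i\<in>(UNIV :: 'n set). of_bool (v ! pos i))"
    by (rule sum_pos[symmetric])
  also have "\<dots> = card (odd_coords x)"
    using assms by (simp add: parity_def)
  finally show ?thesis .
qed

subsection \<open>Weights of the residue code\<close>

definition mid_weight :: "nat \<Rightarrow> bool" where
  "mid_weight n \<longleftrightarrow> 20 \<le> n \<and> n \<le> 36"

text \<open>The upper bound 36 also covers the complements, so the all-one row can be left out of the
  enumeration.\<close>

fun coset_ok :: "bool list list \<Rightarrow> bool list \<Rightarrow> bool" where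
  "coset_ok [] v = mid_weight (trues v)"
| "coset_ok (r # rs) v = (coset_ok rs v \<and> coset_ok rs (vxor v r))"

fun span_ok :: "bool list list \<Rightarrow> bool" where
  "span_ok [] = True"
| "span_ok (r # rs) = (coset_ok rs r \<and> span_ok rs)"

lemma comb_Suc_shift: "comb g (Suc k) a = a 0 *s g 0 + comb (g \<circ> Suc) k (a \<circ> Suc)"
  by (simp add: comb_def sum.lessThan_Suc_shift del: sum.lessThan_Suc)

text \<open>Modulo 2 only the parity of a coefficient matters; the two cases are the two branches of
  \<open>coset_ok\<close>.\<close>

lemma double_add_scale:
  fixes x y :: "Z4 ^ 'n"
  shows "2 *s (x + (a *s z + y)) = 2 *s (if 2 * a = 0 then x + y else (x + z) + y)"
proof -
  have "2 *s (x + (a *s z + y)) = 2 *s x + (2 * a) *s z + 2 *s y"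
    by (simp add: vec_eq_iff distrib_left mult.assoc)
  then show ?thesis
    using two_times_Z4_cases[of a] by (auto simp: vector_add_ldistrib)
qed

text \<open>Each recursive call fixes the parity of one coefficient, so the leaves run through the
  whole coset of \<open>v\<close>.\<close>

lemma coset_ok:
  assumes "coset_ok rs v" "parity v x" "\<And>i. i < length rs \<Longrightarrow> parity (rs ! i) (g i)"
  shows "mid_weight (card (odd_coords (x + comb g (length rs) a)))"
  using assms
proof (induction rs v arbitrary: x g a rule: coset_ok.induct)
  case (1 v)
  then show ?case by (simp add: comb_def trues_parity)
next
  case (2 r rs v)
  have r: "parity r (g 0)" and rs: "\<And>i. i < length rs \<Longrightarrow> parity (rs ! i) ((g \<circ> Suc) i)"
    using "2.prems"(3)[of 0] "2.prems"(3)[of "Suc _"] by auto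
  let ?y = "comb (g \<circ> Suc) (length rs) (a \<circ> Suc)"
  have "mid_weight (card (odd_coords (x + ?y)))"
    using "2.prems" rs by (intro "2.IH"(1)) auto
  moreover have "mid_weight (card (odd_coords ((x + g 0) + ?y)))"
    using "2.prems" rs r by (intro "2.IH"(2) parity_vxor) auto
  moreover have "odd_coords (x + comb g (length (r # rs)) a)
      = odd_coords (if 2 * a 0 = 0 then x + ?y else (x + g 0) + ?y)"
    by (rule odd_coords_cong) (simp only: double_add_scale comb_Suc_shift length_Cons)
  ultimately show ?case by (simp split: if_splits)
qed

text \<open>Nonzero combinations are sorted by the first row with odd coefficient; those sharing
  that row form a coset of the span of the later rows.\<close>

lemma span_ok:
  assumes "span_ok rs" "\<And>i. i < length rs \<Longrightarrow> parity (rs ! i) (g i)" "\<exists>i<length rs. 2 * a i \<noteq> 0"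
  shows "mid_weight (card (odd_coords (comb g (length rs) a)))"
  using assms
proof (induction rs arbitrary: g a)
  case (Cons r rs)
  have r: "parity r (g 0)" and rs: "\<And>i. i < length rs \<Longrightarrow> parity (rs ! i) ((g \<circ> Suc) i)"
    using Cons.prems(2)[of 0] Cons.prems(2)[of "Suc _"] by auto
  let ?y = "comb (g \<circ> Suc) (length rs) (a \<circ> Suc)"
  have *: "odd_coords (comb g (length (r # rs)) a) = odd_coords (if 2 * a 0 = 0 then ?y else g 0 + ?y)"
    using double_add_scale[of 0 "a 0" "g 0" ?y]
    by (intro odd_coords_cong) (simp add: comb_Suc_shift split: if_splits)
  show ?case
  proof (cases "2 * a 0 = 0")
    case True
    then have "\<exists>i<length rs. 2 * (a \<circ> Suc) i \<noteq> 0"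
      using Cons.prems(3) by (auto simp: less_Suc_eq_0_disj)
    then have "mid_weight (card (odd_coords ?y))"
      using Cons.prems(1) rs by (intro Cons.IH) auto
    then show ?thesis using True * by simp
  next
    case False
    have "mid_weight (card (odd_coords (g 0 + ?y)))"
      using Cons.prems(1) r rs by (intro coset_ok) auto
    then show ?thesis using False * by simp
  qed
qed simp

lemma residue_weight:
  fixes g :: "nat \<Rightarrow> Z4 ^ 'n"
  assumes "CARD('n) = 56" "g 0 = 1" "span_ok rs"
    "\<And>i. i < length rs \<Longrightarrow> parity (rs ! i) (g (Suc i))" "\<exists>i<Suc (length rs). 2 * a i \<noteq> 0"
  shows "20 \<le> card (odd_coords (comb g (Suc (length rs)) a))"
proof -
  let ?y = "comb (g \<circ> Suc) (length rs) (a \<circ> Suc)"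
  have *: "odd_coords (comb g (Suc (length rs)) a) = odd_coords (if 2 * a 0 = 0 then ?y else 1 + ?y)"
    using double_add_scale[of 0 "a 0" "g 0" ?y] assms(2)
    by (intro odd_coords_cong) (simp add: comb_Suc_shift split: if_splits)
  have y: "mid_weight (card (odd_coords ?y))" if "\<exists>i<length rs. 2 * (a \<circ> Suc) i \<noteq> 0"
    using assms that by (intro span_ok) auto
  show ?thesis
  proof (cases "2 * a 0 = 0")
    case True
    then have "\<exists>i<length rs. 2 * (a \<circ> Suc) i \<noteq> 0"
      using assms(5) by (auto simp: less_Suc_eq_0_disj)
    then show ?thesis using y True * by (simp add: mid_weight_def)
  next
    case False
    \<comment> \<open>Adding the all-one word complements the support, so an upper bound 36 becomes
      a lower bound 20.\<close>
    have "odd_coords (1 + ?y) = - odd_coords ?y"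
      unfolding set_eq_iff odd_coords_add by (simp add: odd_coords_def)
    then have "card (odd_coords (1 + ?y)) = 56 - card (odd_coords ?y)"
      using assms(1) by (simp add: Compl_eq_Diff_UNIV card_Diff_subset)
    moreover have "card (odd_coords ?y) \<le> 36"
    proof (cases "\<exists>i<length rs. 2 * (a \<circ> Suc) i \<noteq> 0")
      case True
      then show ?thesis using y by (simp add: mid_weight_def)
    next
      case False
      then have "2 *s ?y = 0" unfolding comb_double by (simp add: comb_def)
      then have "odd_coords ?y = {}" by (simp add: odd_coords_eq_empty_iff)
      then show ?thesis by simp
    qed
    ultimately show ?thesis using False * by simp
  qed
qed

subsection \<open>Minimum weight of the dual residue code\<close>

fun pair_sums :: "bool list list \<Rightarrow> bool list list" where
  "pair_sums [] = []"
| "pair_sums (c # cs) = map (vxor c) cs @ pair_sums cs"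

lemma nth_vxor_in_pair_sums:
  "i < j \<Longrightarrow> j < length cs \<Longrightarrow> vxor (cs ! i) (cs ! j) \<in> set (pair_sums cs)"
proof (induction cs arbitrary: i j)
  case (Cons c cs)
  then show ?case by (cases i; cases j) auto
qed simp

text \<open>Sums with the first column form the initial block. Distinctness inside it recovers the
  partner; disjointness from the remainder excludes mixed cases.\<close>

lemma distinct_pair_sums_less:
  assumes "distinct (pair_sums cs)" "i < j" "j < length cs" "k < l" "l < length cs"
    "vxor (cs ! i) (cs ! j) = vxor (cs ! k) (cs ! l)"
  shows "i = k \<and> j = l"
  using assms
proof (induction cs arbitrary: i j k l)
  case (Cons c cs)
  obtain j' l' where jl: "j = Suc j'" "l = Suc l'"
    using Cons.prems by (metis less_imp_Suc_add)
  show ?case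
  proof (cases i; cases k)
    assume ik: "i = 0" "k = 0"
    then have "map (vxor c) cs ! j' = map (vxor c) cs ! l'"
      using Cons.prems jl by simp
    then have "j' = l'"
      using Cons.prems jl by (subst (asm) nth_eq_iff_index_eq) auto
    then show ?thesis using ik jl by simp
  next
    fix k' assume ik: "i = 0" "k = Suc k'"
    then have "vxor c (cs ! j') \<in> set (pair_sums cs)"
      using Cons.prems jl nth_vxor_in_pair_sums[of k' l' cs] by simp
    moreover have "vxor c (cs ! j') \<in> vxor c ` set cs" using Cons.prems jl by simp
    ultimately show ?thesis using Cons.prems(1) by auto
  next
    fix i' assume ik: "i = Suc i'" "k = 0"
    then have "vxor c (cs ! l') \<in> set (pair_sums cs)"
      using Cons.prems jl nth_vxor_in_pair_sums[of i' j' cs] by simp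
    moreover have "vxor c (cs ! l') \<in> vxor c ` set cs" using Cons.prems jl by simp
    ultimately show ?thesis using Cons.prems(1) by auto
  next
    fix i' k' assume "i = Suc i'" "k = Suc k'"
    then show ?thesis using Cons.prems jl Cons.IH[of i' j' k' l'] by simp
  qed
qed simp

lemma distinct_pair_sums:
  assumes "distinct (pair_sums cs)" "i \<noteq> j" "i < length cs" "j < length cs"
    "k \<noteq> l" "k < length cs" "l < length cs" "vxor (cs ! i) (cs ! j) = vxor (cs ! k) (cs ! l)"
  shows "{i, j} = {k, l}"
  using assms(2,5)
proof (elim linorder_neqE_nat)
  assume "i < j" "k < l"
  then show ?thesis using distinct_pair_sums_less[of cs i j k l] assms by auto
next
  assume "i < j" "l < k"
  then show ?thesis using distinct_pair_sums_less[of cs i j l k] assms vxor_commute[of "cs ! k"] by auto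
next
  assume "j < i" "k < l"
  then show ?thesis using distinct_pair_sums_less[of cs j i k l] assms vxor_commute[of "cs ! i"] by auto
next
  assume "j < i" "l < k"
  then show ?thesis using distinct_pair_sums_less[of cs j i l k] assms vxor_commute[of "cs ! i"]
      vxor_commute[of "cs ! k"] by auto
qed

text \<open>Distinctness by splitting on the first bit, since \<open>distinct\<close> needs quadratically many
  comparisons.\<close>

fun sel :: "bool \<Rightarrow> bool list list \<Rightarrow> bool list list" where
  "sel b [] = []"
| "sel True ((True # x) # xs) = x # sel True xs"
| "sel False ((False # x) # xs) = x # sel False xs"
| "sel b (x # xs) = sel b xs"

fun radix_distinct :: "nat \<Rightarrow> bool list list \<Rightarrow> bool" where
  "radix_distinct n [] = True"
| "radix_distinct n [x] = True"
| "radix_distinct 0 (x # y # xs) = False"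
| "radix_distinct (Suc n) (x # y # xs) =
    (radix_distinct n (sel True (x # y # xs)) \<and> radix_distinct n (sel False (x # y # xs)))"

lemma in_set_sel: "y \<in> set (sel b xs) \<longleftrightarrow> b # y \<in> set xs"
  by (induction b xs rule: sel.induct) auto

lemma distinct_if_distinct_sel:
  assumes "[] \<notin> set xs" "distinct (sel True xs)" "distinct (sel False xs)"
  shows "distinct xs"
  using assms
proof (induction xs)
  case (Cons x xs)
  obtain b y where x: "x = b # y" using Cons.prems(1) by (cases x) auto
  have "distinct xs" using Cons x by (cases b) auto
  moreover have "y \<notin> set (sel b xs)" using Cons.prems x by (cases b) auto
  ultimately show ?case using x by (simp add: in_set_sel)
qed simp

text \<open>Both halves of a split must be distinct. Two vectors left at length 0 would coincide,
  hence \<open>False\<close> there.\<close>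

lemma radix_distinct:
  "radix_distinct n xs \<Longrightarrow> \<forall>x\<in>set xs. length x = n \<Longrightarrow> distinct xs"
proof (induction n xs rule: radix_distinct.induct)
  case (4 n x y xs)
  have len: "\<forall>z\<in>set (sel b (x # y # xs)). length z = n" for b
  proof
    fix z assume "z \<in> set (sel b (x # y # xs))"
    then have "length (b # z) = Suc n" using "4.prems"(2) unfolding in_set_sel by blast
    then show "length z = n" by simp
  qed
  have ok: "radix_distinct n (sel True (x # y # xs))" "radix_distinct n (sel False (x # y # xs))"
    using "4.prems"(1) by (simp_all only: radix_distinct.simps)
  show ?case
  proof (rule distinct_if_distinct_sel)
    show "[] \<notin> set (x # y # xs)" using "4.prems"(2) by (metis list.size(3) nat.distinct(1))
    show "distinct (sel True (x # y # xs))" by (rule "4.IH"(1)[OF ok(1) len])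
    show "distinct (sel False (x # y # xs))" by (rule "4.IH"(2)[OF ok(2) len])
  qed
qed simp_all

definition columns :: "nat \<Rightarrow> bool list list \<Rightarrow> bool list list" where
  "columns n B = map (\<lambda>j. map (\<lambda>r. r ! j) B) [0..<n]"

lemma length_pair_sums:
  assumes "\<forall>c\<in>set cs. length c = n" "x \<in> set (pair_sums cs)"
  shows "length x = n"
  using assms by (induction cs) (auto simp: vxor_eq_map2)

text \<open>The columns indexed by the support of \<open>t\<close> sum to zero modulo 2. Row 0 makes
  the weight even, so only 2 and 4 need to be excluded.\<close>

lemma torsion_weight:
  fixes g :: "nat \<Rightarrow> Z4 ^ 'n"
  assumes card: "6 \<le> CARD('n)" and k: "0 < k" and one: "g 0 = 1" and len: "length rs = k"
    and par: "\<And>i. i < k \<Longrightarrow> parity (rs ! i) (g i)"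
    and radix: "radix_distinct k (pair_sums (columns CARD('n) rs))"
    and t: "annihilates g k t" "odd_coords t \<noteq> {}"
  shows "6 \<le> card (odd_coords t)"
proof (rule ccontr)
  let ?c = "columns CARD('n) rs" and ?S = "odd_coords t"
  assume "\<not> 6 \<le> card ?S"
  have col: "length (?c ! pos j) = k" "i < k \<Longrightarrow> ?c ! pos j ! i \<longleftrightarrow> j \<in> odd_coords (g i)" for i j
    using par[of i] len pos_less[of j] by (simp_all add: columns_def parity_def)
  have length: "length ?c = CARD('n)" by (simp add: columns_def)
  have "\<forall>c\<in>set ?c. length c = k" by (simp add: columns_def len)
  then have "distinct (pair_sums ?c)"
    using radix length_pair_sums by (intro radix_distinct) blast+
  then have pairs: "{a, b} = {c, d}"
    if "a \<noteq> b" "c \<noteq> d" "\<And>i. i < k \<Longrightarrow> (a \<in> odd_coords (g i)) \<noteq> (b \<in> odd_coords (g i))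
        \<longleftrightarrow> (c \<in> odd_coords (g i)) \<noteq> (d \<in> odd_coords (g i))" for a b c d
  proof -
    have "vxor (?c ! pos a) (?c ! pos b) = vxor (?c ! pos c) (?c ! pos d)"
      using that(3) by (intro nth_equalityI) (simp_all add: vxor_eq_map2 col)
    then have "{pos a, pos b} = {pos c, pos d}"
      using that(1,2) \<open>distinct (pair_sums ?c)\<close>
      by (intro distinct_pair_sums[of ?c]) (simp_all add: pos_eq_iff length pos_less)
    then show ?thesis by (auto simp: doubleton_eq_iff pos_eq_iff)
  qed
  have even: "even (card (?S \<inter> odd_coords (g i)))" if "i < k" for i
    using t(1) that by (simp add: annihilates_def two_scalar_product_eq_0_iff)
  have "even (card ?S)"
    using even[OF k] one by (simp add: odd_coords_def)
  moreover have "card ?S \<noteq> 0" using t(2) by simp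
  ultimately have "card ?S = 2 \<or> card ?S = 4"
    using \<open>\<not> 6 \<le> card ?S\<close> by presburger
  then consider "card ?S = 2" | "card ?S = 4" by blast
  then show False
  proof cases
    case 1
    then obtain a b where S: "?S = {a, b}" "a \<noteq> b" by (auto simp: card_2_iff)
    \<comment> \<open>Weight 2 means equal columns at \<open>a\<close> and \<open>b\<close>; adding
      any third column \<open>c\<close> to both produces a coincidence of pair sums.\<close>
    have "card {a, b} < CARD('n)" using card S(2) by simp
    then have "UNIV \<noteq> {a, b}" by auto
    then obtain c where c: "c \<noteq> a" "c \<noteq> b" by auto
    have "a \<in> odd_coords (g i) \<longleftrightarrow> b \<in> odd_coords (g i)" if "i < k" for i
      using even[OF that] S
      by (cases "a \<in> odd_coords (g i)"; cases "b \<in> odd_coords (g i)") simp_all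
    then have "{a, c} = {b, c}" using c by (intro pairs) auto
    then show False using S(2) by (auto simp: doubleton_eq_iff)
  next
    case 2
    obtain xs where xs: "set xs = ?S" "distinct xs"
      using finite_distinct_list[OF finite[of ?S]] by blast
    then have "length xs = 4" using 2 distinct_card[of xs] by simp
    then obtain a b c d where abcd: "xs = [a, b, c, d]"
      by (auto simp: length_Suc_conv numeral_eq_Suc)
    have S: "?S = {a, b, c, d}" "distinct [a, b, c, d]" using xs abcd by simp_all
    \<comment> \<open>Four columns with sum zero split into two pairs with equal sums.\<close>
    have "(a \<in> odd_coords (g i)) \<noteq> (b \<in> odd_coords (g i))
        \<longleftrightarrow> (c \<in> odd_coords (g i)) \<noteq> (d \<in> odd_coords (g i))" if "i < k" for i
      using even[OF that] S
      by (cases "a \<in> odd_coords (g i)"; cases "b \<in> odd_coords (g i)";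
          cases "c \<in> odd_coords (g i)"; cases "d \<in> odd_coords (g i)") simp_all
    then have "{a, b} = {c, d}" using S(2) by (intro pairs) auto
    then show False using S(2) by (auto simp: doubleton_eq_iff)
  qed
qed

subsection \<open>Certificates\<close>

definition gens :: "int list list \<Rightarrow> nat \<Rightarrow> Z4 ^ 56" where
  "gens G i = of_list (G ! i)"

lemma annihilates_mono: "annihilates g k t \<Longrightarrow> m \<le> k \<Longrightarrow> annihilates g m t"
  by (simp add: annihilates_def)

text \<open>One matrix serves every \<open>k\<close> from \<open>m\<close> to its length: weight
  bounds pass from all rows to fewer rows, while dual bounds pass from the first \<open>m\<close>
  rows to more rows.\<close>

lemma certified_codes:
  fixes G :: "int list list"
  assumes hd: "G = replicate 56 1 # G'"
    and length: "\<forall>r\<in>set G. length r = 56"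
    and orth: "\<forall>r\<in>set G. \<forall>s\<in>set G. 4 dvd dot r s"
    and norm: "\<forall>r\<in>set G. 8 dvd dot r r"
    and span: "span_ok (map (map odd) G')"
    and radix: "radix_distinct m (pair_sums (columns 56 (map (map odd) (take m G))))"
    and t: "length t = 56" "trues (map odd t) = 6" "\<forall>r\<in>set G. even (dot t r)"
    and k: "0 < m" "m \<le> k" "k \<le> length G"
  shows "extremal_type_II (lift_code (gens G) k)"
    and "card ((*s) 2 ` lift_code (gens G) k) = 2 ^ k"
proof -
  have len: "length (G ! i) = CARD(56)" if "i < length G" for i
    using length that by simp
  have one: "gens G 0 = 1"
    using pos_less[where ?'n = 56] by (simp add: gens_def hd of_list_def vec_eq_iff)
  have par: "parity (map odd (G ! i)) (gens G i)" if "i < length G" for i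
    unfolding gens_def using len[OF that] by (rule parity_of_list)
  have residue: "20 \<le> card (odd_coords (comb (gens G) k a))" if a: "\<exists>i<k. 2 * a i \<noteq> 0" for a
  proof -
    \<comment> \<open>Padding by 0 turns a combination of \<open>k\<close> rows into one of all
      rows, which is what was enumerated.\<close>
    let ?a = "\<lambda>i. if i < k then a i else 0"
    have "20 \<le> card (odd_coords (comb (gens G) (Suc (length (map (map odd) G'))) ?a))"
    proof (rule residue_weight)
      show "\<exists>i<Suc (length (map (map odd) G')). 2 * ?a i \<noteq> 0"
        using a k by (fastforce simp: hd)
      show "parity (map (map odd) G' ! i) (gens G (Suc i))" if "i < length (map (map odd) G')" for i
        using that par[of "Suc i"] by (simp add: hd)
    qed (use one span in simp_all)
    also have "Suc (length (map (map odd) G')) = length G" by (simp add: hd)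
    also have "comb (gens G) (length G) ?a = comb (gens G) k a"
      unfolding comb_def using k by (intro sum.mono_neutral_cong_right) auto
    finally show ?thesis .
  qed
  show "card ((*s) 2 ` lift_code (gens G) k) = 2 ^ k"
    using residue by (intro card_double_lift_code) fastforce
  show "extremal_type_II (lift_code (gens G) k)"
  proof (rule extremal_lift_code[where t = "of_list t"])
    show "scalar_product (gens G i) (gens G j) = 0" if "i < k" "j < k" for i j
      unfolding gens_def using that k len orth by (subst scalar_product_of_list_eq_0_iff) simp_all
    show "8 dvd euclidean_weight (gens G i)" if "i < k" for i
      unfolding gens_def using that k len norm by (intro euclidean_weight_of_list_dvd) simp_all
    show "6 \<le> card (odd_coords s)" if "annihilates (gens G) k s" "odd_coords s \<noteq> {}" for s
    proof (rule torsion_weight[where rs = "map (map odd) (take m G)" and k = m])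
      show "annihilates (gens G) m s" using that k annihilates_mono by blast
      show "parity (map (map odd) (take m G) ! i) (gens G i)" if "i < m" for i
        using that k par[of i] by simp
    qed (use k one radix that in simp_all)
    show "annihilates (gens G) k (of_list t)"
      unfolding annihilates_def gens_def
      using k len t by (auto simp: double_scalar_product_of_list_eq_0_iff)
    show "card (odd_coords (of_list t :: Z4 ^ 56)) = 6"
    proof -
      have "trues (map odd t) = card (odd_coords (of_list t :: Z4 ^ 56))"
        by (intro trues_parity parity_of_list) (simp add: t)
      then show ?thesis using t by simp
    qed
  qed (use k one residue in auto)
qed


subsection \<open>Three codes\<close>

text \<open>The residue codes are quasi-cyclic of index 8: each block of 7 coordinates carries
  \<open>x \<mapsto> Tr (a x + b / x) + c\<close> on the nonzero elements of the field with 8 elements, where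
  \<open>(a\<^sub>1, \<dots>, a\<^sub>8)\<close> and \<open>(b\<^sub>1, \<dots>, b\<^sub>8)\<close> run through two orthogonal codes of dimension 2 over that
  field, found by a random search. The entries 2 and 3 make the rows orthogonal modulo 4 and their
  Euclidean weights divisible by 8.\<close>

definition gens_13 :: "int list list" where
  "gens_13 = replicate 56 1 #
   [[3,2,2,1,2,1,1,0,0,0,0,0,0,0,1,0,0,1,0,1,1,1,0,0,1,0,1,1,1,0,0,1,0,1,1,1,0,0,1,0,1,1,1,0,0,1,0,1,1,1,0,0,1,0,1,1],
    [2,2,1,2,1,1,3,0,0,0,0,0,0,0,0,0,1,0,1,1,1,0,0,1,0,1,1,1,0,0,1,0,1,1,1,0,0,1,0,1,1,1,0,0,1,0,1,1,1,0,0,1,0,1,1,1],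
    [2,1,2,1,1,3,2,0,0,0,0,0,0,0,0,1,0,1,1,1,0,0,1,0,1,1,1,0,0,1,0,1,1,1,0,0,1,0,1,1,1,0,0,1,0,1,1,1,0,0,1,0,1,1,1,0],
    [2,2,0,0,0,0,2,3,0,0,1,0,1,1,0,0,1,0,1,1,1,1,0,1,1,1,0,0,0,1,0,1,1,1,0,0,1,1,1,0,0,1,1,1,0,0,1,0,1,1,1,1,0,0,1,0],
    [2,0,2,2,0,0,2,2,0,3,0,1,1,1,0,1,0,1,1,1,0,0,1,1,1,0,0,1,1,0,1,1,1,0,0,1,1,1,0,0,1,0,1,0,0,1,0,1,1,1,1,0,0,1,0,1],
    [2,0,2,2,2,0,2,2,3,2,1,1,1,0,1,0,1,1,1,0,0,1,1,1,0,0,1,0,0,1,1,1,0,0,1,1,1,0,0,1,0,1,0,0,1,0,1,1,1,1,0,0,1,0,1,1],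
    [2,3,3,1,0,1,0,1,2,1,0,0,1,1,1,1,0,1,0,0,1,0,0,1,1,1,0,1,0,1,1,1,0,1,0,1,1,1,0,1,0,0,0,1,1,1,0,1,0,0,1,1,1,0,1,0],
    [0,2,3,3,1,0,1,1,1,2,1,0,0,1,1,1,1,0,1,0,0,1,0,0,1,1,1,0,0,0,1,1,1,0,1,0,1,1,1,0,1,0,0,0,1,1,1,0,1,0,0,1,1,1,0,1],
    [1,0,2,1,1,1,2,3,3,1,0,1,0,0,0,1,1,1,0,1,0,0,1,0,0,1,1,1,1,0,0,1,1,1,0,0,0,1,1,1,0,1,1,0,0,1,1,1,0,1,0,0,1,1,1,0],
    [3,0,3,2,0,1,3,2,0,1,1,1,0,1,0,0,2,0,0,0,0,1,1,0,1,0,0,1,0,1,1,1,0,1,0,0,0,1,1,1,0,1,0,1,0,0,1,1,1,0,1,1,1,0,1,0],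
    [1,1,0,1,0,0,1,3,0,2,1,1,1,0,2,0,2,0,0,0,0,1,1,1,0,1,0,0,0,0,1,1,1,0,1,1,0,0,1,1,1,0,1,0,1,0,0,1,1,0,0,1,1,1,0,1],
    [3,3,3,0,1,2,0,2,1,0,0,1,1,1,2,0,0,0,0,0,0,0,1,1,1,0,1,0,1,0,0,1,1,1,0,0,1,0,0,1,1,1,1,1,0,1,0,0,1,1,0,0,1,1,1,0]]"

text \<open>The last two rows reduce modulo 2 to words constant on each block of 7. Dropping the
  final row gives the code of dimension 14.\<close>

definition gens_15 :: "int list list" where
  "gens_15 = replicate 56 1 #
   [[1,0,0,1,0,1,1,0,0,0,0,0,0,0,1,0,0,1,0,1,1,1,0,0,1,0,1,1,1,0,0,1,0,1,1,0,0,0,0,0,0,0,1,0,0,1,0,1,1,1,0,0,1,0,1,1],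
    [0,0,1,0,1,1,1,0,0,0,0,0,0,0,0,0,1,0,1,1,1,0,0,1,0,1,1,1,0,0,1,0,1,1,1,0,0,0,0,0,0,0,0,0,1,0,1,1,1,0,0,1,0,1,1,1],
    [0,1,0,1,1,1,0,0,0,0,0,0,0,0,0,1,0,1,1,1,0,0,1,0,1,1,1,0,0,1,0,1,1,1,0,0,0,0,0,0,0,0,0,1,0,1,1,1,0,0,1,0,1,1,1,0],
    [0,0,0,0,0,0,0,3,2,2,1,2,1,1,0,0,1,0,1,1,1,1,0,0,1,0,1,1,0,1,1,1,0,0,1,1,1,1,0,0,1,0,0,1,0,1,1,1,0,0,1,1,1,0,0,1],
    [2,2,2,0,2,0,0,2,2,1,2,1,1,3,0,1,0,1,1,1,0,0,0,1,0,1,1,1,1,1,1,0,0,1,0,1,1,0,0,1,0,1,1,0,1,1,1,0,0,1,1,1,0,0,1,0],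
    [2,2,0,2,0,0,2,2,1,2,1,1,3,2,1,0,1,1,1,0,0,0,1,0,1,1,1,0,1,1,0,0,1,0,1,1,0,0,1,0,1,1,0,1,1,1,0,0,1,1,1,0,0,1,0,1],
    [3,0,1,2,2,3,1,0,0,3,3,3,0,3,1,1,0,1,0,0,1,1,0,1,0,0,1,1,1,1,1,0,1,0,0,1,0,1,0,0,1,1,1,1,1,0,1,0,0,1,1,0,1,0,0,1],
    [1,3,0,1,2,2,3,3,0,0,3,3,3,0,1,1,1,0,1,0,0,1,1,0,1,0,0,1,0,1,1,1,0,1,0,1,1,0,1,0,0,1,0,1,1,1,0,1,0,1,1,1,0,1,0,0],
    [3,1,3,0,1,2,2,0,3,0,0,3,3,3,0,1,1,1,0,1,0,1,1,1,0,1,0,0,0,0,1,1,1,0,1,1,1,1,0,1,0,0,0,0,1,1,1,0,1,0,1,1,1,0,1,0],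
    [1,0,0,1,1,1,0,1,0,0,1,1,3,2,0,1,1,1,0,1,0,1,1,0,1,0,0,1,0,0,0,0,0,0,0,0,1,1,1,0,1,0,1,1,1,0,1,0,0,1,1,0,1,0,0,1],
    [0,1,0,0,1,1,1,2,1,0,0,1,1,3,0,0,1,1,1,0,1,1,1,1,0,1,0,0,0,0,0,0,0,0,0,0,0,1,1,1,0,1,0,1,1,1,0,1,0,1,1,1,0,1,0,0],
    [1,0,1,0,0,1,1,3,2,1,0,0,1,1,1,0,0,1,1,1,0,0,1,1,1,0,1,0,0,0,0,0,0,0,0,1,0,0,1,1,1,0,0,0,1,1,1,0,1,0,1,1,1,0,1,0],
    [1,1,3,1,1,1,3,3,1,3,1,1,3,1,2,0,0,0,0,0,0,1,1,1,1,1,1,1,1,1,1,1,1,1,1,0,0,0,0,0,0,0,0,0,0,0,0,0,0,0,0,0,0,0,0,0],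
    [2,2,0,2,2,2,0,1,3,1,3,3,1,3,3,1,1,1,1,1,1,1,1,1,1,1,1,1,0,0,0,0,0,0,0,1,1,1,1,1,1,1,0,0,0,0,0,0,0,0,0,0,0,0,0,0]]"

definition tight_13 :: "int list" where
  "tight_13 =
    [1,1,1,1,0,0,0,0,0,0,0,0,0,0,0,1,0,0,0,0,0,0,0,0,0,0,0,0,0,0,0,0,0,0,0,0,0,0,0,0,0,0,0,0,0,0,0,0,0,0,0,0,0,1,0,0]"

text \<open>Being orthogonal modulo 2 to all 15 rows, this word also serves the code from the first
  14.\<close>

definition tight_15 :: "int list" where
  "tight_15 =
    [1,1,1,0,0,0,0,0,1,0,0,0,0,0,0,0,0,0,0,0,0,0,0,0,0,0,0,1,0,1,0,0,0,0,0,0,0,0,0,0,0,0,0,0,0,0,0,0,0,0,0,0,0,0,0,0]"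

lemma check_rows:
  "\<forall>r\<in>set gens_13. length r = 56" "\<forall>r\<in>set gens_15. length r = 56"
  "\<forall>r\<in>set gens_13. \<forall>s\<in>set gens_13. 4 dvd dot r s"
  "\<forall>r\<in>set gens_15. \<forall>s\<in>set gens_15. 4 dvd dot r s"
  "\<forall>r\<in>set gens_13. 8 dvd dot r r" "\<forall>r\<in>set gens_15. 8 dvd dot r r"
  by code_simp+

lemma check_tight:
  "length tight_13 = 56" "trues (map odd tight_13) = 6" "\<forall>r\<in>set gens_13. even (dot tight_13 r)"
  "length tight_15 = 56" "trues (map odd tight_15) = 6" "\<forall>r\<in>set gens_15. even (dot tight_15 r)"
  by code_simp+

lemma check_span_13: "span_ok (map (map odd) (tl gens_13))"
  by code_simp

text \<open>The enumeration covers the \<open>2 ^ 14 - 1\<close> nonzero combinations of the rows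
  after the all-one row.\<close>

lemma check_span_15: "span_ok (map (map odd) (tl gens_15))"
  by code_simp

text \<open>Each check compares the 1540 sums of two of the 56 columns. For \<open>gens_15\<close>,
  14 rows already separate them, which settles dimension 15 too.\<close>

lemma check_radix:
  "radix_distinct 13 (pair_sums (columns 56 (map (map odd) (take 13 gens_13))))"
  "radix_distinct 14 (pair_sums (columns 56 (map (map odd) (take 14 gens_15))))"
  by code_simp+

lemma gens_Cons_length:
  "gens_13 = replicate 56 1 # tl gens_13" "length gens_13 = 13"
  "gens_15 = replicate 56 1 # tl gens_15" "length gens_15 = 15"
  by (simp_all only: gens_13_def gens_15_def list.sel) simp_all

theorem proposition4p5:
  shows "\<exists>S :: (Z4 ^ 56) set set.
           card S = 3 \<and> (\<forall>C\<in>S. extremal_type_II C) \<and> pairwise (\<lambda>C D. \<not> code_equiv C D) S"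
proof -
  \<comment> \<open>The index is the dimension of the residue code; 14 and 15 share a
    matrix.\<close>
  define C where "C k = lift_code (gens (if k = 13 then gens_13 else gens_15)) k" for k
  have C: "extremal_type_II (C k)" "card ((*s) 2 ` C k) = 2 ^ k" if "k \<in> {13, 14, 15}" for k
    using that
      certified_codes[OF gens_Cons_length(1) check_rows(1,3,5) check_span_13 check_radix(1)
        check_tight(1-3), of 13]
      certified_codes[OF gens_Cons_length(3) check_rows(2,4,6) check_span_15 check_radix(2)
        check_tight(4-6), of k]
    unfolding C_def gens_Cons_length(2,4) by auto
  have inequiv: "\<not> code_equiv (C k) (C l)" if "k \<in> {13, 14, 15}" "l \<in> {13, 14, 15}" "k \<noteq> l" for k l
  proof
    assume "code_equiv (C k) (C l)"
    then have "(2 :: nat) ^ k = 2 ^ l"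
      using code_equiv_card_double C(2)[OF that(1)] C(2)[OF that(2)] by metis
    then show False using \<open>k \<noteq> l\<close> by simp
  qed
  \<comment> \<open>The same invariant shows that the three codes are distinct as sets.\<close>
  have "inj_on C {13, 14, 15}"
  proof (rule inj_onI)
    fix k l assume kl: "k \<in> {13, 14, 15 :: nat}" "l \<in> {13, 14, 15}" "C k = C l"
    have "(2 :: nat) ^ k = 2 ^ l"
      unfolding C(2)[OF kl(1), symmetric] C(2)[OF kl(2), symmetric] kl(3) ..
    then show "k = l" by simp
  qed
  then have "card (C ` {13, 14, 15}) = 3" by (simp add: card_image del: image_insert)
  moreover have "\<forall>D\<in>C ` {13, 14, 15}. extremal_type_II D"
  proof
    fix D assume "D \<in> C ` {13, 14, 15}"
    then obtain k where "k \<in> {13, 14, 15}" "D = C k" by (rule imageE)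
    then show "extremal_type_II D" using C(1) by simp
  qed
  moreover have "pairwise (\<lambda>C D. \<not> code_equiv C D) (C ` {13, 14, 15})"
  proof (rule pairwiseI)
    fix D E assume DE: "D \<in> C ` {13, 14, 15}" "E \<in> C ` {13, 14, 15}" "D \<noteq> E"
    obtain k where k: "k \<in> {13, 14, 15}" "D = C k" using DE(1) by (rule imageE)
    obtain l where l: "l \<in> {13, 14, 15}" "E = C l" using DE(2) by (rule imageE)
    show "\<not> code_equiv D E" using inequiv[OF k(1) l(1)] DE(3) k(2) l(2) by metis
  qed
  ultimately show ?thesis by (intro exI[of _ "C ` {13, 14, 15}"] conjI)
qed

end
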